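(* Let $h\in\Sigma^\alpha[1]$ with $\alpha\in(0,2]$, $$\mu:=\lim_{z\to1,\,z\in\Delta}(1-z)^{1+\alpha}h'(z)\ne\infty,$$ and let $F_t(z):=h^{-1}(h(z)+t)$, $z\in\Delta$, $t\ge0$. Then $h(\Delta)$ lies in a horizontal half-plane if and only if, for every $z\in\Delta$, $$\sup_{t\ge0}\frac{t\,(1-|F_t(z)|)}{|1-F_t(z)|}=:M(z)<\infty.$$ Moreover, in this case the following assertions hold: (a) $\alpha$ must belong to the half-open interval $(0,1]$; (b) $|\arg\mu|=\dfrac{\pi}{2}\alpha$; (c) all the trajectories $\{F_t(z)\}_{t\ge0}$, $z\in\Delta$, converge tangentially to the point $z=1$; (d) if, for some real $b\neq 0$, $\Pi=\left\{w=\dfrac{ibz}{1-z}:z\in\Delta\right\}$ is a half-plane containing $h(\Delta)$, then $b\cdot\arg\mu>0$.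
   Context: $\Delta$ is the open unit disk in $\mathbb{C}$. $\Sigma[1]$ is the class of univalent holomorphic functions $h:\Delta\to\mathbb{C}$ such that $h(0)=0$, $h(z)+t\in h(\Delta)$ for all $z\in\Delta$, $t\ge0$, and $\lim_{t\to\infty}h^{-1}(h(z)+t)=1$ for all $z\in\Delta$. For $\alpha\ge0$, $\Sigma^\alpha[1]$ is the class of those $h\in\Sigma[1]$ for which the unrestricted limit $\lim_{z\to1,\,z\in\Delta}(1-z)^{1+\alpha}h'(z)$ exists, is finite and is different from zero. Powers of $1-z$ and $\arg$ are principal values. A horizontal half-plane is a half-plane whose boundary is parallel to the real axis. The trajectory $\{F_t(z)\}_{t\ge0}$ converges to $1$ tangentially if $F_t(z)\to1$ and $\lim_{t\to\infty}\frac{1-|F_t(z)|}{|1-F_t(z)|}=0$. *)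

theory Defs
  imports "HOL-Complex_Analysis.Complex_Analysis"
begin

abbreviation unit_disk :: "complex set" ("\<Delta>") where
  "\<Delta> \<equiv> ball 0 1"

text \<open>Only values at points \<open>z \<in> \<Delta>\<close> and times \<open>t \<ge> 0\<close> with \<open>h z + t \<in> h ` \<Delta>\<close> are
  meaningful; for \<open>h\<close> in \<open>Sigma_class\<close> this holds for all \<open>z \<in> \<Delta>\<close> and \<open>t \<ge> 0\<close>.\<close>

definition flow :: "(complex \<Rightarrow> complex) \<Rightarrow> real \<Rightarrow> complex \<Rightarrow> complex" where
  "flow h t z = inv_into \<Delta> h (h z + of_real t)"

definition Sigma_class :: "(complex \<Rightarrow> complex) set" where
  "Sigma_class = {h. h holomorphic_on \<Delta> \<and> inj_on h \<Delta> \<and> h 0 = 0 \<and>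
     (\<forall>z\<in>\<Delta>. \<forall>t\<ge>0. h z + of_real t \<in> h ` \<Delta>) \<and>
     (\<forall>z\<in>\<Delta>. ((\<lambda>t. flow h t z) \<longlongrightarrow> 1) at_top)}"

text \<open>Since \<open>Re (1 - z) > 0\<close> on \<open>\<Delta>\<close>, \<open>powr\<close> is the principal power here.\<close>

definition Sigma_alpha :: "real \<Rightarrow> (complex \<Rightarrow> complex) set" where
  "Sigma_alpha \<alpha> = {h \<in> Sigma_class. \<exists>\<mu>. \<mu> \<noteq> 0 \<and>
     ((\<lambda>z. (1 - z) powr of_real (1 + \<alpha>) * deriv h z) \<longlongrightarrow> \<mu>) (at 1 within \<Delta>)}"

definition horizontal_half_plane :: "complex set \<Rightarrow> bool" where
  "horizontal_half_plane H \<longleftrightarrow> (\<exists>c. H = {w. Im w > c} \<or> H = {w. Im w < c})"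

definition converges_tangentially_to_1 :: "(real \<Rightarrow> complex) \<Rightarrow> bool" where
  "converges_tangentially_to_1 \<gamma> \<longleftrightarrow>
     (\<gamma> \<longlongrightarrow> 1) at_top \<and> ((\<lambda>t. (1 - norm (\<gamma> t)) / norm (1 - \<gamma> t)) \<longlongrightarrow> 0) at_top"

end

theory Submission
  imports Defs
begin

text \<open>Write \<open>F\<close> for \<open>flow h t z\<close>. Integrating the hypothesis on \<open>h'\<close> gives
  \<open>(1 - z) powr \<alpha> * h z \<longlongrightarrow> \<mu> / \<alpha>\<close>, hence \<open>t * (1 - F) powr \<alpha> \<longlongrightarrow> \<mu> / \<alpha>\<close> along every
  trajectory. Comparing moduli, \<open>t * (1 - \<bar>F\<bar>) / \<bar>1 - F\<bar>\<close> is asymptotically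
  \<open>\<bar>h' F\<bar> * (1 - \<bar>F\<bar>) / \<alpha>\<close>, which by the Schwarz lemma is at least half the
  distance from \<open>h z + t\<close> to the complement of the image, divided by \<open>\<alpha>\<close>.

  If the image lies in a horizontal half-plane, the Schwarz lemma for functions with positive real
  part bounds \<open>\<bar>h' F\<bar> * (1 - \<bar>F\<bar>)\<close> by twice the constant distance from \<open>h z + t\<close> to the edge of the half-plane.
  Conversely, if the distance stays bounded, there are points outside the image arbitrarily far to
  the right at bounded height; as the image is invariant under shifts to the right, it misses the
  whole horizontal line at any limiting height, and connectedness puts it on one side.

  For the assertions on \<open>\<alpha>\<close> and \<open>Arg \<mu>\<close>, approach \<open>1\<close> along the rays
  \<open>1 - \<rho> * cis \<theta>\<close>: membership in the upper half-plane forces \<open>sin (Arg \<mu> - \<alpha> * \<theta>) \<ge> 0\<close> for all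
  \<open>\<bar>\<theta>\<bar> < pi / 2\<close>, whereas the behaviour of the trajectories gives \<open>\<bar>Arg \<mu>\<bar> \<le> \<alpha> * pi / 2\<close>.\<close>

section \<open>A Schwarz-type derivative bound and an interval argument for the sine\<close>

text \<open>Rescaling to the unit disk and applying the Cayley transform that sends
  \<open>f z\<close> to 0 gives a self-map \<open>G\<close> of the disk fixing 0. Schwarz bounds
  \<open>deriv G 0\<close>, which is \<open>r * deriv f z / (2 * Re (f z))\<close>. Later
  \<open>f\<close> is built once from \<open>h\<close> and once from its inverse.\<close>

lemma deriv_le_of_Re_pos:
  assumes hol: "f holomorphic_on ball z r" and r: "0 < r"
    and pos: "\<And>w. w \<in> ball z r \<Longrightarrow> 0 < Re (f w)"
  shows "r * norm (deriv f z) \<le> 2 * Re (f z)"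
proof -
  define G where "G = (\<lambda>w. (f (z + of_real r * w) - f z) / (f (z + of_real r * w) + cnj (f z)))"
  have in_ball: "z + of_real r * w \<in> ball z r" if "norm w < 1" for w
    using that r by (simp add: dist_norm norm_mult)
  have fz: "0 < Re (f z)"
    using pos[of z] r by simp
  have nz: "f (z + of_real r * w) + cnj (f z) \<noteq> 0" if "norm w < 1" for w
    using pos[OF in_ball[OF that]] fz by (auto simp: complex_eq_iff)
  have hol_comp: "(\<lambda>w. f (z + of_real r * w)) holomorphic_on ball 0 1"
    using in_ball
    by (intro holomorphic_on_compose_gen[OF _ hol, unfolded o_def] holomorphic_intros) auto
  have holG: "G holomorphic_on ball 0 1"
    unfolding G_def using nz by (intro holomorphic_intros hol_comp) auto
  have G0: "G 0 = 0"
    by (simp add: G_def)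
  have G1: "norm (G w) < 1" if "norm w < 1" for w
  proof -
    let ?a = "f (z + of_real r * w)"
    \<comment> \<open>Geometrically, a point of the right half-plane is nearer to \<open>f z\<close>
      than to the mirror image \<open>- cnj (f z)\<close>.\<close>
    have "(norm (?a + cnj (f z)))\<^sup>2 - (norm (?a - f z))\<^sup>2 = 4 * Re ?a * Re (f z)"
      by (simp add: cmod_power2) algebra
    moreover have "0 < 4 * Re ?a * Re (f z)"
      using pos[OF in_ball[OF that]] fz by simp
    ultimately have "(norm (?a - f z))\<^sup>2 < (norm (?a + cnj (f z)))\<^sup>2"
      by linarith
    then have "norm (?a - f z) < norm (?a + cnj (f z))"
      using norm_ge_zero power2_less_imp_less by blast
    then show ?thesis
      using nz[OF that] by (simp add: G_def norm_divide)
  qed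
  have df: "(f has_field_derivative deriv f z) (at (z + of_real r * 0))"
    using holomorphic_derivI[OF hol, of z] r by simp
  have dcomp: "((\<lambda>w. f (z + of_real r * w)) has_field_derivative deriv f z * of_real r) (at 0)"
    by (rule DERIV_chain'[where f = "\<lambda>w. z + of_real r * w" and g = f, OF _ df])
      (auto intro!: derivative_eq_intros)
  have cz: "f z + cnj (f z) \<noteq> 0"
    using nz[of 0] by simp
  have "(G has_field_derivative deriv f z * of_real r / (f z + cnj (f z))) (at 0)"
    unfolding G_def
    using DERIV_divide[OF DERIV_diff[OF dcomp DERIV_const] DERIV_add[OF dcomp DERIV_const], of "cnj (f z)" "f z"] cz
    by simp
  then have "deriv G 0 = deriv f z * of_real r / (f z + cnj (f z))"
    by (rule DERIV_imp_deriv)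
  moreover have "norm (deriv G 0) \<le> 1"
    by (rule Schwarz_Lemma(2)[OF holG G0 G1, where \<xi> = 0]) auto
  moreover have "norm (f z + cnj (f z)) = 2 * Re (f z)"
    using fz by (simp add: complex_add_cnj norm_mult)
  ultimately show ?thesis
    using fz r by (simp add: norm_divide norm_mult mult.commute)
qed

text \<open>The points \<open>\<phi> - x\<close> fill an open interval of length
  \<open>pi * \<alpha>\<close>, which must fit into one closed arc of length \<open>pi\<close> where
  the sine is nonnegative. If its centre also satisfies
  \<open>\<bar>\<phi>\<bar> \<le> pi / 2 * \<alpha>\<close>, the arc is \<open>[0, pi]\<close>, and
  the left end of the interval forces \<open>\<phi> \<ge> pi / 2 * \<alpha>\<close>.\<close>

lemma sin_nonneg_interval:
  fixes \<alpha> \<phi> :: real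
  assumes "0 < \<alpha>" "\<alpha> \<le> 2"
    and sin: "\<And>x. \<bar>x\<bar> < pi / 2 * \<alpha> \<Longrightarrow> 0 \<le> sin (\<phi> - x)"
  shows "\<alpha> \<le> 1" and "\<bar>\<phi>\<bar> \<le> pi / 2 * \<alpha> \<Longrightarrow> \<phi> = pi / 2 * \<alpha>"
proof -
  show le1: "\<alpha> \<le> 1"
  proof (rule ccontr)
    assume "\<not> \<alpha> \<le> 1"
    then have gt: "pi / 2 < pi / 2 * \<alpha>"
      by simp
    define p where "p = pi / 2 * \<alpha>"
    \<comment> \<open>The sine has opposite values at points \<open>pi\<close> apart, so it vanishes
      where both are nonnegative. This is used for \<open>x = - pi / 2, pi / 2\<close> and for the
      same pair moved by \<open>e\<close>. Half the slack keeps the moved pair admissible; the cap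
      gives \<open>e < pi\<close>, so the two zeros found are incompatible.\<close>
    define e where "e = min (pi / 2) ((p - pi / 2) / 2)"
    have e: "0 < e" "e < pi" "\<bar>e - pi / 2\<bar> < pi / 2 * \<alpha>" "\<bar>e + pi / 2\<bar> < pi / 2 * \<alpha>"
    proof -
      have "e \<le> pi / 2" "e \<le> (p - pi / 2) / 2"
        unfolding e_def by (rule min.cobounded1 min.cobounded2)+
      moreover have "0 < e"
        using gt by (simp add: e_def p_def)
      ultimately show "0 < e" "e < pi" "\<bar>e - pi / 2\<bar> < pi / 2 * \<alpha>" "\<bar>e + pi / 2\<bar> < pi / 2 * \<alpha>"
        using gt pi_gt_zero by (simp_all add: p_def field_simps)
    qed
    have "\<bar>pi / 2\<bar> < pi / 2 * \<alpha>" "\<bar>- (pi / 2)\<bar> < pi / 2 * \<alpha>"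
      using gt by auto
    then have "0 \<le> sin (\<phi> - pi / 2)" "0 \<le> sin (\<phi> - - (pi / 2))"
      using sin by blast+
    then have c: "cos \<phi> = 0"
      by (simp add: sin_add sin_diff)
    have "0 \<le> sin (\<phi> - (e - pi / 2))" "0 \<le> sin (\<phi> - (e + pi / 2))"
      using sin e by blast+
    moreover have "sin (\<phi> - (e - pi / 2)) = cos (\<phi> - e)" "sin (\<phi> - (e + pi / 2)) = - cos (\<phi> - e)"
      using sin_add[of "\<phi> - e" "pi / 2"] sin_diff[of "\<phi> - e" "pi / 2"]
      by (simp_all add: algebra_simps)
    ultimately have "cos (\<phi> - e) = 0"
      by linarith
    then have "sin \<phi> * sin e = 0"
      using c by (simp add: cos_diff)
    moreover have "sin \<phi> \<noteq> 0"
      using c sin_cos_squared_add[of \<phi>] by force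
    ultimately show False
      using sin_gt_zero[OF e(1,2)] by simp
  qed
  define p where "p = pi / 2 * \<alpha>"
  assume "\<bar>\<phi>\<bar> \<le> pi / 2 * \<alpha>"
  then have abs: "\<bar>\<phi>\<bar> \<le> p"
    by (simp add: p_def)
  have pa: "0 < p" "p \<le> pi / 2"
    using \<open>0 < \<alpha>\<close> le1 by (simp_all add: p_def mult_left_le)
  have "\<phi> \<ge> 0"
  proof (rule ccontr)
    assume "\<not> \<phi> \<ge> 0"
    then have "sin (- \<phi>) > 0"
      using abs pa pi_gt_zero by (intro sin_gt_zero) linarith+
    then show False
      using sin[of 0] pa by (simp add: p_def)
  qed
  show "\<phi> = pi / 2 * \<alpha>"
    unfolding p_def[symmetric]
  proof (rule ccontr)
    assume "\<phi> \<noteq> p"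
    then have lt: "\<phi> < p"
      using abs by linarith
    \<comment> \<open>The midpoint is still admissible but already exceeds \<phi>, so the sine at
      \<open>\<phi> - x\<close> is negative.\<close>
    define x where "x = (\<phi> + p) / 2"
    have "\<bar>x\<bar> < p"
      unfolding x_def using lt \<open>\<phi> \<ge> 0\<close> pa by simp
    moreover have "sin (x - \<phi>) > 0"
      unfolding x_def using lt \<open>\<phi> \<ge> 0\<close> pa by (intro sin_gt_zero) (auto simp: field_simps)
    moreover have "sin (\<phi> - x) = - sin (x - \<phi>)"
      by (metis minus_diff_eq sin_minus)
    ultimately show False
      using sin[of x] by (simp add: p_def)
  qed
qed

subsection \<open>Unrestricted boundary asymptotics\<close>

text \<open>Integrate the derivative from the fixed point \<open>1 - \<delta>\<close> along the
  radius to \<open>1 - r\<close>, where \<open>r = norm (1 - z)\<close>, then along the chord to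
  \<open>z\<close>. Both pieces contribute a small multiple of \<open>r powr - \<alpha>\<close>,
  uniformly in the direction of approach.\<close>

lemma tendsto_of_deriv_littleo:
  fixes g :: "complex \<Rightarrow> complex" and \<alpha> :: real
  assumes hol: "g holomorphic_on ball 0 1" and \<alpha>: "0 < \<alpha>"
    and lim: "((\<lambda>z. norm (1 - z) powr (1 + \<alpha>) * norm (deriv g z)) \<longlongrightarrow> 0) (at 1 within ball 0 1)"
  shows "((\<lambda>z. norm (1 - z) powr \<alpha> * norm (g z)) \<longlongrightarrow> 0) (at 1 within ball 0 1)"
proof (rule tendstoI)
  fix e :: real assume "0 < e"
  \<comment> \<open>The first summand comes from the chord, the second from the radius. The choice
    of \<epsilon> makes both together cost \<open>e / 2\<close>; the other half is left for the
    constant \<open>A\<close>.\<close>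
  define C where "C = 2 powr (2 + \<alpha>) + 1 / \<alpha>"
  have "C > 0"
    using \<alpha> by (auto simp: C_def intro: add_pos_pos)
  define \<epsilon> where "\<epsilon> = e / (2 * C)"
  have "\<epsilon> > 0" and \<epsilon>C: "\<epsilon> * C = e / 2"
    using \<open>0 < e\<close> \<open>C > 0\<close> by (simp_all add: \<epsilon>_def)
  obtain d0 where "d0 > 0" and d0: "\<And>z. z \<in> ball 0 1 \<Longrightarrow> z \<noteq> 1 \<Longrightarrow> dist z 1 < d0 \<Longrightarrow>
      norm (1 - z) powr (1 + \<alpha>) * norm (deriv g z) < \<epsilon>"
    using tendstoD[OF lim \<open>\<epsilon> > 0\<close>] unfolding eventually_at by auto
  \<comment> \<open>Halving makes the derivative bound available on the closed range
    \<open>norm (1 - z) \<le> \<delta>\<close>; \<open>\<delta> < 1\<close> keeps the base point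
    \<open>1 - \<delta>\<close> in the disk.\<close>
  define \<delta> where "\<delta> = min d0 1 / 2"
  have \<delta>: "0 < \<delta>" "\<delta> < d0" "\<delta> < 1"
    using \<open>d0 > 0\<close> by (auto simp: \<delta>_def min_def)
  have dg: "norm (deriv g z) \<le> \<epsilon> * norm (1 - z) powr - (1 + \<alpha>)"
    if "z \<in> ball 0 1" "norm (1 - z) \<le> \<delta>" for z
  proof -
    have "z \<noteq> 1"
      using that by auto
    then have "norm (1 - z) powr (1 + \<alpha>) * norm (deriv g z) < \<epsilon>"
      using that \<delta> by (intro d0) (auto simp: dist_norm norm_minus_commute)
    moreover have "0 < norm (1 - z) powr (1 + \<alpha>)"
      using \<open>z \<noteq> 1\<close> by simp
    ultimately show ?thesis
      unfolding powr_minus_divide by (simp add: field_simps)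
  qed
  have radial: "norm (g (of_real (1 - r)) - g (of_real (1 - \<delta>))) \<le> \<epsilon> / \<alpha> * r powr - \<alpha>"
    if "0 < r" "r < \<delta>" for r
  proof -
    \<comment> \<open>A primitive of the bound for the derivative on the radius; its value at
      \<open>1 - \<delta>\<close> is nonnegative and gets dropped.\<close>
    define \<phi> where "\<phi> = (\<lambda>x. \<epsilon> / \<alpha> * (1 - x) powr - \<alpha>)"
    have der: "((\<lambda>x. g (of_real x)) has_vector_derivative deriv g (of_real x)) (at x)"
      if "x \<in> {1 - \<delta>..1 - r}" for x
    proof -
      have "complex_of_real x \<in> ball 0 1"
        using that \<delta> \<open>0 < r\<close> by auto
      then have "(g has_field_derivative deriv g (of_real x)) (at (of_real x))"
        using holomorphic_derivI[OF hol] by blast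
      then have "(g \<circ> of_real has_vector_derivative 1 * deriv g (of_real x)) (at x)"
        by (intro field_vector_diff_chain_at) (auto intro!: derivative_eq_intros)
      then show ?thesis
        by (simp add: o_def)
    qed
    have d\<phi>: "(\<phi> has_real_derivative \<epsilon> * (1 - x) powr - (1 + \<alpha>)) (at x)"
      if "x \<in> {1 - \<delta>..1 - r}" for x
    proof -
      have "0 < 1 - x"
        using that \<open>0 < r\<close> by auto
      show ?thesis
        unfolding \<phi>_def using \<open>0 < 1 - x\<close> \<alpha>
        by (auto intro!: derivative_eq_intros simp: field_simps powr_diff powr_minus powr_add)
    qed
    have "norm (g (of_real (1 - r)) - g (of_real (1 - \<delta>))) \<le> \<phi> (1 - r) - \<phi> (1 - \<delta>)"
    proof (rule differentiable_bound_general)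
      show "1 - \<delta> < 1 - r" using that by simp
      show "continuous_on {1 - \<delta>..1 - r} (\<lambda>x. g (of_real x))"
        using der by (meson continuous_at_imp_continuous_on has_vector_derivative_continuous)
      show "continuous_on {1 - \<delta>..1 - r} \<phi>"
        using d\<phi> by (meson DERIV_isCont continuous_at_imp_continuous_on)
      fix x assume "1 - \<delta> < x" "x < 1 - r"
      then have x: "x \<in> {1 - \<delta>..1 - r}" by simp
      show "((\<lambda>x. g (of_real x)) has_vector_derivative deriv g (of_real x)) (at x)"
        by (rule der[OF x])
      show "(\<phi> has_vector_derivative \<epsilon> * (1 - x) powr - (1 + \<alpha>)) (at x)"
        using d\<phi>[OF x] by (simp add: has_real_derivative_iff_has_vector_derivative)
      have "norm (1 - complex_of_real x) = 1 - x"
        using x \<open>0 < r\<close> by (metis atLeastAtMost_iff abs_of_pos diff_gt_0_iff_gt norm_of_real of_real_1 of_real_diff order_le_less_trans diff_less_eq less_add_same_cancel1)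
      then show "norm (deriv g (of_real x)) \<le> \<epsilon> * (1 - x) powr - (1 + \<alpha>)"
        using dg[of "of_real x"] x \<open>0 < r\<close> \<delta> by auto
    qed
    also have "\<dots> \<le> \<phi> (1 - r)"
      using \<open>\<epsilon> > 0\<close> \<alpha> by (simp add: \<phi>_def)
    finally show ?thesis
      by (simp add: \<phi>_def)
  qed
  \<comment> \<open>The chord from \<open>z\<close> to \<open>1 - r\<close> stays at distance at least \<open>r / 2\<close> from \<open>1\<close>, however
    tangentially \<open>z\<close> approaches the circle, because \<open>Re (1 - z) > 0\<close>.\<close>
  have chord: "norm (g z - g (of_real (1 - r))) \<le> \<epsilon> * 2 powr (2 + \<alpha>) * r powr - \<alpha>"
    if z: "z \<in> ball 0 1" and r: "r = norm (1 - z)" "0 < r" "r < \<delta>" for z r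
  proof -
    have r1: "r < 1" using r \<delta> by simp
    have cr: "complex_of_real (1 - r) \<in> ball 0 1"
      using r r1 by (simp del: of_real_diff)
    have Rez: "0 < Re (1 - z)"
      using z abs_Re_le_cmod[of z] by simp
    have seg: "\<zeta> \<in> ball 0 1" "norm (1 - \<zeta>) \<le> \<delta>" "r / 2 \<le> norm (1 - \<zeta>)"
      if \<zeta>: "\<zeta> \<in> closed_segment z (of_real (1 - r))" for \<zeta>
    proof -
      show "\<zeta> \<in> ball 0 1"
        using closed_segment_subset[OF z cr convex_ball] \<zeta> by blast
      have "z \<in> cball 1 r" "complex_of_real (1 - r) \<in> cball 1 r"
        using r by (auto simp: dist_norm norm_minus_commute)
      then have "\<zeta> \<in> cball 1 r"
        using closed_segment_subset[OF _ _ convex_cball] \<zeta> by blast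
      then show "norm (1 - \<zeta>) \<le> \<delta>"
        using r by (simp add: dist_norm)
      obtain s where s: "0 \<le> s" "s \<le> 1" "\<zeta> = (1 - s) *\<^sub>R z + s *\<^sub>R of_real (1 - r)"
        using \<zeta> by (auto simp: in_segment)
      have eq: "1 - \<zeta> = of_real (1 - s) * (1 - z) + of_real (s * r)"
        by (simp add: s(3) scaleR_conv_of_real algebra_simps)
      have "(norm (1 - \<zeta>))\<^sup>2 = (1 - s)\<^sup>2 * (norm (1 - z))\<^sup>2 + (s * r)\<^sup>2 + 2 * (1 - s) * (s * r) * Re (1 - z)"
        unfolding eq cmod_power2 by simp algebra
      also have "\<dots> \<ge> (1 - s)\<^sup>2 * r\<^sup>2 + s\<^sup>2 * r\<^sup>2"
      proof -
        have "0 \<le> 2 * (1 - s) * (s * r) * Re (1 - z)"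
          using s r Rez by (intro mult_nonneg_nonneg) auto
        then show ?thesis
          by (simp add: r(1) power_mult_distrib)
      qed
      also have "(1 - s)\<^sup>2 * r\<^sup>2 + s\<^sup>2 * r\<^sup>2 \<ge> (r / 2)\<^sup>2"
      proof -
        have "(1 - s)\<^sup>2 + s\<^sup>2 - 1 / 4 = 2 * (s - 1 / 2)\<^sup>2 + 1 / 4"
          by (simp add: power2_eq_square field_simps)
        then have "1 / 4 \<le> (1 - s)\<^sup>2 + s\<^sup>2"
          using zero_le_power2[of "s - 1 / 2"] by linarith
        then have "1 / 4 * r\<^sup>2 \<le> ((1 - s)\<^sup>2 + s\<^sup>2) * r\<^sup>2"
          by (intro mult_right_mono) auto
        then show ?thesis
          by (simp add: algebra_simps power_divide)
      qed
      finally show "r / 2 \<le> norm (1 - \<zeta>)"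
        by (rule power2_le_imp_le) auto
    qed
    \<comment> \<open>The derivative bound at the least possible distance \<open>r / 2\<close>.
      Times the chord length, at most \<open>2 * r\<close>, it yields the factor
      \<open>2 powr (2 + \<alpha>)\<close>.\<close>
    define B where "B = \<epsilon> * (r / 2) powr - (1 + \<alpha>)"
    have "norm (g z - g (of_real (1 - r))) \<le> B * norm (z - of_real (1 - r))"
    proof (rule field_differentiable_bound[where S = "closed_segment z (of_real (1 - r))"])
      fix \<zeta> assume \<zeta>: "\<zeta> \<in> closed_segment z (complex_of_real (1 - r))"
      show "(g has_field_derivative deriv g \<zeta>) (at \<zeta> within closed_segment z (of_real (1 - r)))"
        using holomorphic_derivI[OF hol] seg(1)[OF \<zeta>] has_field_derivative_at_within by blast
      have "norm (deriv g \<zeta>) \<le> \<epsilon> * norm (1 - \<zeta>) powr - (1 + \<alpha>)"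
        by (rule dg[OF seg(1,2)[OF \<zeta>]])
      also have "\<dots> \<le> B"
        unfolding B_def using seg(3)[OF \<zeta>] r \<open>\<epsilon> > 0\<close> \<alpha>
        by (intro mult_left_mono powr_mono2') auto
      finally show "norm (deriv g \<zeta>) \<le> B" .
    qed auto
    also have "\<dots> \<le> B * (2 * r)"
    proof (rule mult_left_mono)
      have "z - of_real (1 - r) = of_real r - (1 - z)" by simp
      then have "norm (z - of_real (1 - r)) \<le> norm (complex_of_real r) + norm (1 - z)"
        by (metis norm_triangle_ineq4)
      then show "norm (z - of_real (1 - r)) \<le> 2 * r"
        using r by simp
    qed (use \<open>\<epsilon> > 0\<close> in \<open>simp add: B_def\<close>)
    also have "\<dots> = \<epsilon> * 2 powr (2 + \<alpha>) * r powr - \<alpha>"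
    proof -
      have "(r / 2) powr - (1 + \<alpha>) * (2 * r) = 2 powr (2 + \<alpha>) * r powr - \<alpha>"
      proof -
        have "(r / 2) powr - (1 + \<alpha>) = r powr - (1 + \<alpha>) * 2 powr (1 + \<alpha>)"
          using r(2) by (simp only: powr_divide powr_minus) (simp add: field_simps)
        then have "(r / 2) powr - (1 + \<alpha>) * (2 * r) = (r powr - (1 + \<alpha>) * r) * (2 * 2 powr (1 + \<alpha>))"
          by (simp only: mult_ac)
        moreover have "r powr - (1 + \<alpha>) * r = r powr - \<alpha>"
          using r(2) powr_mult_base[of r "- (1 + \<alpha>)"] by (simp add: mult.commute)
        moreover have "2 * 2 powr (1 + \<alpha>) = 2 powr (2 + \<alpha>)"
          using powr_mult_base[of 2 "1 + \<alpha>"] by simp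
        ultimately show ?thesis
          by (simp only: mult.commute)
      qed
      then show ?thesis
        by (simp add: B_def)
    qed
    finally show ?thesis .
  qed
  \<comment> \<open>The constant of integration; the factor
    \<open>norm (1 - z) powr \<alpha>\<close> kills it in the limit because
    \<open>\<alpha> > 0\<close>.\<close>
  define A where "A = norm (g (of_real (1 - \<delta>)))"
  have "((\<lambda>z. norm (1 - z) powr \<alpha>) \<longlongrightarrow> norm (1 - 1 :: complex) powr \<alpha>) (at 1 within ball (0::complex) 1)"
    using \<alpha> by (intro tendsto_intros tendsto_powr') auto
  then have "((\<lambda>z. norm (1 - z) powr \<alpha> * A) \<longlongrightarrow> 0) (at 1 within ball (0::complex) 1)"
    using tendsto_mult_left_zero by fastforce
  then have ev1: "\<forall>\<^sub>F z in at 1 within ball (0::complex) 1. norm (1 - z) powr \<alpha> * A < e / 2"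
    using \<open>0 < e\<close> by (intro order_tendstoD(2)) auto
  have ev2: "\<forall>\<^sub>F z in at 1 within ball (0::complex) 1. z \<in> ball 0 1 \<and> norm (1 - z) < \<delta> \<and> 0 < norm (1 - z)"
    unfolding eventually_at using \<delta>(1)
    by (intro exI[of _ \<delta>]) (auto simp: dist_norm norm_minus_commute)
  show "\<forall>\<^sub>F z in at 1 within ball 0 1. dist (norm (1 - z) powr \<alpha> * norm (g z)) 0 < e"
    using ev1 ev2
  proof eventually_elim
    case (elim z)
    define r where "r = norm (1 - z)"
    have r: "0 < r" "r < \<delta>" and z: "z \<in> ball 0 1"
      using elim by (auto simp: r_def)
    have "norm (g z) \<le> norm (g z - g (of_real (1 - r))) + norm (g (of_real (1 - r)) - g (of_real (1 - \<delta>))) + A"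
      unfolding A_def by norm
    also have "\<dots> \<le> \<epsilon> * 2 powr (2 + \<alpha>) * r powr - \<alpha> + \<epsilon> / \<alpha> * r powr - \<alpha> + A"
      using chord[OF z r_def r] radial[OF r] by linarith
    also have "\<dots> = e / 2 * r powr - \<alpha> + A"
      unfolding \<epsilon>C[symmetric] C_def by (simp add: algebra_simps)
    finally have "r powr \<alpha> * norm (g z) \<le> r powr \<alpha> * (e / 2 * r powr - \<alpha> + A)"
      by (rule mult_left_mono) simp
    also have "\<dots> = e / 2 + r powr \<alpha> * A"
      using r by (simp add: powr_minus field_simps)
    also have "\<dots> < e"
      using elim by (simp add: r_def)
    finally show ?case
      by (simp add: r_def abs_mult)
  qed
qed

text \<open>Subtracting \<open>\<mu> / \<alpha> * (1 - z) powr - \<alpha>\<close>, a primitive of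
  the leading term of the derivative, reduces the claim to the case of limit 0, which is
  \<open>tendsto_of_deriv_littleo\<close>.\<close>

lemma tendsto_integrate_powr:
  fixes h :: "complex \<Rightarrow> complex" and \<alpha> :: real
  assumes hol: "h holomorphic_on ball 0 1" and \<alpha>: "0 < \<alpha>"
    and lim: "((\<lambda>z. (1 - z) powr of_real (1 + \<alpha>) * deriv h z) \<longlongrightarrow> \<mu>) (at 1 within ball 0 1)"
  shows "((\<lambda>z. (1 - z) powr of_real \<alpha> * h z) \<longlongrightarrow> \<mu> / of_real \<alpha>) (at 1 within ball 0 1)"
proof -
  define g where "g = (\<lambda>z. h z - \<mu> / of_real \<alpha> * (1 - z) powr - of_real \<alpha>)"
  have Re_pos: "0 < Re (1 - z)" if "z \<in> ball 0 1" for z :: complex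
    using that abs_Re_le_cmod[of z] by simp
  have not_neg: "1 - z \<notin> \<real>\<^sub>\<le>\<^sub>0" if "z \<in> ball 0 1" for z :: complex
    using Re_pos[OF that] by (auto simp: complex_nonpos_Reals_iff)
  have ne1: "z \<noteq> 1" if "z \<in> ball 0 1" for z :: complex
    using that by auto
  have holg: "g holomorphic_on ball 0 1"
    unfolding g_def using not_neg by (intro holomorphic_intros hol) auto
  have dg: "deriv g z = deriv h z - \<mu> * (1 - z) powr - of_real (1 + \<alpha>)" if z: "z \<in> ball 0 1" for z
  proof -
    have dh: "(h has_field_derivative deriv h z) (at z)"
      using holomorphic_derivI[OF hol] z by auto
    have eq: "- complex_of_real \<alpha> - 1 = - of_real (1 + \<alpha>)"
      by simp
    have dp: "((\<lambda>z. (1 - z) powr - of_real \<alpha>) has_field_derivative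
        (- of_real \<alpha> * (1 - z) powr (- of_real \<alpha> - 1)) * (- 1)) (at z)"
      by (rule DERIV_chain'[where f = "\<lambda>z. 1 - z" and g = "\<lambda>w. w powr - of_real \<alpha>",
            OF _ has_field_derivative_powr[OF not_neg[OF z]]])
        (auto intro!: derivative_eq_intros)
    have "(g has_field_derivative deriv h z - \<mu> / of_real \<alpha> *
        ((- of_real \<alpha> * (1 - z) powr (- of_real \<alpha> - 1)) * (- 1))) (at z)"
      unfolding g_def by (intro DERIV_diff dh DERIV_cmult dp)
    then show ?thesis
      unfolding eq using \<alpha> by (subst DERIV_imp_deriv) auto
  qed
  have powr_cancel: "(1 - z) powr of_real a * (1 - z) powr - of_real a = 1"
    if "z \<in> ball 0 1" for z :: complex and a :: real
    using ne1[OF that] by (simp add: powr_minus field_simps)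
  have "((\<lambda>z. (1 - z) powr of_real (1 + \<alpha>) * deriv g z) \<longlongrightarrow> 0) (at 1 within ball 0 1)"
  proof (rule Lim_transform_eventually)
    show "((\<lambda>z. (1 - z) powr of_real (1 + \<alpha>) * deriv h z - \<mu>) \<longlongrightarrow> 0) (at 1 within ball 0 1)"
      using tendsto_diff[OF lim tendsto_const[of \<mu>]] by simp
    show "\<forall>\<^sub>F z in at 1 within ball 0 1. (1 - z) powr of_real (1 + \<alpha>) * deriv h z - \<mu> =
        (1 - z) powr of_real (1 + \<alpha>) * deriv g z"
      unfolding eventually_at_filter
    proof (intro always_eventually allI impI)
      fix z :: complex assume z: "z \<in> ball 0 1"
      have "(1 - z) powr of_real (1 + \<alpha>) * deriv g z = (1 - z) powr of_real (1 + \<alpha>) * deriv h z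
          - \<mu> * ((1 - z) powr of_real (1 + \<alpha>) * (1 - z) powr - of_real (1 + \<alpha>))"
        unfolding dg[OF z] by (simp only: right_diff_distrib mult_ac)
      then show "(1 - z) powr of_real (1 + \<alpha>) * deriv h z - \<mu> = (1 - z) powr of_real (1 + \<alpha>) * deriv g z"
        unfolding powr_cancel[OF z] by simp
    qed
  qed
  then have "((\<lambda>z. norm (1 - z) powr (1 + \<alpha>) * norm (deriv g z)) \<longlongrightarrow> 0) (at 1 within ball 0 1)"
    using tendsto_norm_zero by (fastforce simp: norm_mult norm_powr_real_powr' simp del: of_real_add)
  then have "((\<lambda>z. norm (1 - z) powr \<alpha> * norm (g z)) \<longlongrightarrow> 0) (at 1 within ball 0 1)"
    by (rule tendsto_of_deriv_littleo[OF holg \<alpha>])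
  then have "((\<lambda>z. norm ((1 - z) powr of_real \<alpha> * g z)) \<longlongrightarrow> 0) (at 1 within ball 0 1)"
    by (simp add: norm_mult norm_powr_real_powr')
  then have "((\<lambda>z. (1 - z) powr of_real \<alpha> * g z) \<longlongrightarrow> 0) (at 1 within ball 0 1)"
    by (rule tendsto_norm_zero_cancel)
  then have "((\<lambda>z. (1 - z) powr of_real \<alpha> * g z + \<mu> / of_real \<alpha>) \<longlongrightarrow> \<mu> / of_real \<alpha>) (at 1 within ball 0 1)"
    using tendsto_add[OF _ tendsto_const] by fastforce
  then show ?thesis
  proof (rule Lim_transform_eventually)
    show "\<forall>\<^sub>F z in at 1 within ball 0 1. (1 - z) powr of_real \<alpha> * g z + \<mu> / of_real \<alpha> =
        (1 - z) powr of_real \<alpha> * h z"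
      unfolding eventually_at_filter g_def
      using powr_cancel[of _ \<alpha>] by (intro always_eventually) (auto simp: algebra_simps)
  qed
qed

section \<open>Domains invariant under shifts to the right\<close>

text \<open>Openness turns a limiting height \<open>y\<close> of missing points into a missed
  height: a disc in \<open>S\<close> centred at height \<open>y\<close> sweeps out, when shifted
  right, a strip that would contain missing points.\<close>

lemma starlike_at_infinity_half_plane:
  fixes S :: "complex set"
  assumes conn: "connected S" and "open S"
    and shift: "\<And>w t. w \<in> S \<Longrightarrow> 0 \<le> t \<Longrightarrow> w + of_real t \<in> S"
    and missing: "\<And>T. \<exists>\<zeta>. \<zeta> \<notin> S \<and> T \<le> Re \<zeta> \<and> \<bar>Im \<zeta>\<bar> \<le> K"
  shows "\<exists>H. horizontal_half_plane H \<and> S \<subseteq> H"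
proof -
  have "\<forall>n::nat. \<exists>\<zeta>. \<zeta> \<notin> S \<and> real n \<le> Re \<zeta> \<and> \<bar>Im \<zeta>\<bar> \<le> K"
    using missing by blast
  then obtain \<zeta> where \<zeta>: "\<And>n::nat. \<zeta> n \<notin> S \<and> real n \<le> Re (\<zeta> n) \<and> \<bar>Im (\<zeta> n)\<bar> \<le> K"
    by metis
  have "\<forall>n. Im (\<zeta> n) \<in> {- K..K}"
    using \<zeta> by (auto simp: abs_le_iff minus_le_iff)
  then obtain y r where r: "strict_mono r" and y: "((\<lambda>n. Im (\<zeta> n)) \<circ> r) \<longlonglongrightarrow> y"
    using seq_compactE[OF compact_imp_seq_compact[OF compact_Icc[of "- K" K]], of "\<lambda>n. Im (\<zeta> n)"] by metis
  have miss: "Im w \<noteq> y" if "w \<in> S" for w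
  proof
    assume "Im w = y"
    obtain e where "e > 0" and e: "ball w e \<subseteq> S"
      using \<open>open S\<close> \<open>w \<in> S\<close> open_contains_ball by blast
    have "\<forall>\<^sub>F n in sequentially. dist (Im (\<zeta> (r n))) y < e"
      using tendstoD[OF y \<open>e > 0\<close>] by (simp add: o_def)
    moreover have "\<forall>\<^sub>F n in sequentially. Re w \<le> real n"
      by (meson eventually_sequentiallyI le_nat_iff real_nat_ceiling_ge of_nat_le_iff order_trans)
    ultimately obtain n where n: "dist (Im (\<zeta> (r n))) y < e" "Re w \<le> real n"
      using eventually_conj eventually_happens' by (metis (mono_tags, lifting) sequentially_bot)
    have "Re w \<le> Re (\<zeta> (r n))"
      using n(2) \<zeta>[of "r n"] seq_suble[OF r, of n] by linarith
    \<comment> \<open>Move \<open>w\<close> vertically inside the disc to the height of the missing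
      point, then shift it right onto that point.\<close>
    moreover have "Complex (Re w) (Im (\<zeta> (r n))) \<in> S"
      using e n(1) \<open>Im w = y\<close> by (auto simp: dist_norm cmod_def abs_minus_commute subset_iff)
    ultimately have "Complex (Re w) (Im (\<zeta> (r n))) + of_real (Re (\<zeta> (r n)) - Re w) \<in> S"
      by (intro shift) auto
    moreover have "Complex (Re w) (Im (\<zeta> (r n))) + of_real (Re (\<zeta> (r n)) - Re w) = \<zeta> (r n)"
      by (simp add: complex_eq_iff)
    ultimately show False
      using \<zeta> by metis
  qed
  have conn_Im: "connected (Im ` S)"
    by (intro connected_continuous_image conn continuous_intros)
  have "(\<forall>w\<in>S. y < Im w) \<or> (\<forall>w\<in>S. Im w < y)"
  proof (rule ccontr)
    assume "\<not> ?thesis"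
    then obtain v w where vw: "v \<in> S" "Im v \<le> y" "w \<in> S" "y \<le> Im w"
      by (auto simp: not_less)
    have "y \<in> Im ` S"
      by (rule connectedD_interval[OF conn_Im imageI[OF vw(1)] imageI[OF vw(3)] vw(2,4)])
    then show False
      using miss by auto
  qed
  then show ?thesis
    unfolding horizontal_half_plane_def by blast
qed

subsection \<open>Trajectories and the geometry of the image\<close>

locale Sigma_asymptotics =
  fixes h :: "complex \<Rightarrow> complex" and \<alpha> :: real and \<mu> :: complex
  assumes \<alpha>_pos: "0 < \<alpha>" and Sigma: "h \<in> Sigma_class" and \<mu>_nz: "\<mu> \<noteq> 0"
    and lim_deriv: "((\<lambda>z. (1 - z) powr of_real (1 + \<alpha>) * deriv h z) \<longlongrightarrow> \<mu>) (at 1 within \<Delta>)"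
begin

lemma holomorphic: "h holomorphic_on \<Delta>"
  and inj: "inj_on h \<Delta>"
  using Sigma by (auto simp: Sigma_class_def)

lemma flow_in_disk: "z \<in> \<Delta> \<Longrightarrow> 0 \<le> t \<Longrightarrow> flow h t z \<in> \<Delta>"
  and h_flow: "z \<in> \<Delta> \<Longrightarrow> 0 \<le> t \<Longrightarrow> h (flow h t z) = h z + of_real t"
proof -
  assume "z \<in> \<Delta>" "0 \<le> t"
  then have *: "h z + of_real t \<in> h ` \<Delta>"
    using Sigma by (simp add: Sigma_class_def)
  show "flow h t z \<in> \<Delta>" "h (flow h t z) = h z + of_real t"
    unfolding flow_def by (rule inv_into_into[OF *], rule f_inv_into_f[OF *])
qed

lemma norm_flow_less_1: "z \<in> \<Delta> \<Longrightarrow> 0 \<le> t \<Longrightarrow> norm (flow h t z) < 1"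
  using flow_in_disk by simp

text \<open>Allows unrestricted limits at 1 to be evaluated along a trajectory.\<close>

lemma filterlim_flow:
  assumes "z \<in> \<Delta>"
  shows "filterlim (\<lambda>t. flow h t z) (at 1 within \<Delta>) at_top"
proof -
  have "\<forall>\<^sub>F t in at_top. flow h t z \<in> \<Delta> \<and> flow h t z \<noteq> 1"
    using eventually_ge_at_top[of 0]
    by eventually_elim (use flow_in_disk[OF assms] in fastforce)
  then show ?thesis
    using assms Sigma by (auto simp: Sigma_class_def filterlim_at)
qed

lemma lim_h: "((\<lambda>z. (1 - z) powr of_real \<alpha> * h z) \<longlongrightarrow> \<mu> / of_real \<alpha>) (at 1 within \<Delta>)"
  by (rule tendsto_integrate_powr[OF holomorphic \<alpha>_pos lim_deriv])

text \<open>Along the trajectory \<open>h\<close> equals \<open>h z + t\<close>, and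
  \<open>(h z + t) / t\<close> tends to 1, so \<open>h\<close> may be replaced by \<open>t\<close>
  in \<open>lim_h\<close>.\<close>

lemma lim_flow_powr:
  assumes z: "z \<in> \<Delta>"
  shows "((\<lambda>t. of_real t * (1 - flow h t z) powr of_real \<alpha>) \<longlongrightarrow> \<mu> / of_real \<alpha>) at_top"
proof -
  have "((\<lambda>t. (1 - flow h t z) powr of_real \<alpha> * h (flow h t z)) \<longlongrightarrow> \<mu> / of_real \<alpha>) at_top"
    by (rule filterlim_compose[OF lim_h filterlim_flow[OF z]])
  moreover have "((\<lambda>t. h z / of_real t + 1) \<longlongrightarrow> 0 + 1) at_top"
    by (intro tendsto_intros tendsto_divide_0[OF tendsto_const])
  ultimately have "((\<lambda>t. (1 - flow h t z) powr of_real \<alpha> * h (flow h t z) / (h z / of_real t + 1))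
      \<longlongrightarrow> \<mu> / of_real \<alpha> / (0 + 1)) at_top"
    by (intro tendsto_divide) auto
  moreover have "\<forall>\<^sub>F t in at_top. (1 - flow h t z) powr of_real \<alpha> * h (flow h t z) / (h z / of_real t + 1) =
      of_real t * (1 - flow h t z) powr of_real \<alpha>"
    \<comment> \<open>Beyond this threshold \<open>t\<close> is positive and \<open>h z + t\<close>
      is nonzero, so the division is legitimate.\<close>
    using eventually_gt_at_top[of "norm (h z)"]
  proof eventually_elim
    case (elim t)
    have "0 < t"
      using elim norm_ge_zero[of "h z"] by linarith
    moreover have "h z + of_real t \<noteq> 0"
    proof
      assume "h z + of_real t = 0"
      then have "h z = - of_real t"
        by (simp add: eq_neg_iff_add_eq_0)
      then show False
        using elim \<open>0 < t\<close> by simp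
    qed
    moreover have "h z / of_real t + 1 = (h z + of_real t) / of_real t"
      using \<open>0 < t\<close> by (simp add: field_simps)
    ultimately show ?case
      using elim by (simp add: h_flow[OF z])
  qed
  ultimately show ?thesis
    using Lim_transform_eventually by fastforce
qed

text \<open>Dividing the limits of \<open>t * norm (1 - F) powr \<alpha>\<close> and
  \<open>norm (1 - F) powr (1 + \<alpha>) * norm (deriv h F)\<close> shows that
  \<open>t / norm (1 - F)\<close> is asymptotic to \<open>norm (deriv h F) / \<alpha>\<close>. The
  factors 2 give room for inequalities that hold eventually.\<close>

lemma quotient_asymptotics:
  assumes z: "z \<in> \<Delta>"
  shows "\<forall>\<^sub>F t in at_top.
      t * (1 - norm (flow h t z)) / norm (1 - flow h t z)
        \<le> 2 / \<alpha> * (norm (deriv h (flow h t z)) * (1 - norm (flow h t z)))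
    \<and> norm (deriv h (flow h t z)) * (1 - norm (flow h t z))
        \<le> 2 * \<alpha> * (t * (1 - norm (flow h t z)) / norm (1 - flow h t z))"
proof -
  let ?F = "\<lambda>t. flow h t z"
  define a where "a = (\<lambda>t. t * norm (1 - ?F t) powr \<alpha>)"
  define b where "b = (\<lambda>t. norm (1 - ?F t) powr (1 + \<alpha>) * norm (deriv h (?F t)))"
  have "((\<lambda>t. norm (of_real t * (1 - ?F t) powr of_real \<alpha>)) \<longlongrightarrow> norm (\<mu> / of_real \<alpha>)) at_top"
    by (rule tendsto_norm[OF lim_flow_powr[OF z]])
  moreover have "\<forall>\<^sub>F t in at_top. norm (of_real t * (1 - ?F t) powr of_real \<alpha>) = a t"
    using eventually_ge_at_top[of 0]
    by eventually_elim (simp add: a_def norm_mult norm_powr_real_powr')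
  ultimately have a: "(a \<longlongrightarrow> norm \<mu> / \<alpha>) at_top"
    using Lim_transform_eventually \<alpha>_pos by (fastforce simp: norm_divide)
  have "((\<lambda>t. norm ((1 - ?F t) powr of_real (1 + \<alpha>) * deriv h (?F t))) \<longlongrightarrow> norm \<mu>) at_top"
    by (rule tendsto_norm[OF filterlim_compose[OF lim_deriv filterlim_flow[OF z]]])
  then have b: "(b \<longlongrightarrow> norm \<mu>) at_top"
    unfolding b_def by (simp add: norm_mult norm_powr_real_powr' del: of_real_add)
  have q: "((\<lambda>t. a t / b t) \<longlongrightarrow> 1 / \<alpha>) at_top"
    using tendsto_divide[OF a b] \<mu>_nz by simp
  have "1 / (2 * \<alpha>) < 1 / \<alpha>" "1 / \<alpha> < 2 / \<alpha>"
    using \<alpha>_pos by (simp_all add: field_simps)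
  then have "\<forall>\<^sub>F t in at_top. 1 / (2 * \<alpha>) < a t / b t" "\<forall>\<^sub>F t in at_top. a t / b t < 2 / \<alpha>"
    using order_tendstoD[OF q] by blast+
  moreover have "\<forall>\<^sub>F t in at_top. 0 < b t"
    using order_tendstoD(1)[OF b, of 0] \<mu>_nz by simp
  ultimately show ?thesis
    using eventually_ge_at_top[of 0]
  proof eventually_elim
    case (elim t)
    let ?D = "norm (deriv h (?F t)) * (1 - norm (?F t))"
    have F1: "norm (?F t) < 1"
      by (rule norm_flow_less_1[OF z elim(4)])
    then have "?F t \<noteq> 1"
      by auto
    then have "t * (1 - norm (?F t)) / norm (1 - ?F t) = a t / b t * ?D"
      using elim(3) by (auto simp: a_def b_def powr_add)
    moreover have D: "0 \<le> ?D"
      using F1 by simp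
    moreover have "a t / b t * ?D \<le> 2 / \<alpha> * ?D"
      using elim D by (intro mult_right_mono) auto
    moreover have "?D = 2 * \<alpha> * (1 / (2 * \<alpha>) * ?D)"
      using \<alpha>_pos by simp
    moreover have "2 * \<alpha> * (1 / (2 * \<alpha>) * ?D) \<le> 2 * \<alpha> * (a t / b t * ?D)"
      using elim D \<alpha>_pos by (intro mult_left_mono mult_right_mono) auto
    ultimately show ?case
      by simp
  qed
qed

section \<open>Boundedness along trajectories versus containment in a half-plane\<close>

text \<open>\<open>Im (h (flow h t z))\<close> does not depend on \<open>t\<close>, so the
  derivative bound in a half-plane is uniform along the trajectory. The sign \<sigma> selects an
  upper or a lower half-plane.\<close>

lemma bounded_of_half_plane:
  assumes \<sigma>: "\<bar>\<sigma>\<bar> = 1" and half: "\<And>w. w \<in> \<Delta> \<Longrightarrow> c < \<sigma> * Im (h w)" and z: "z \<in> \<Delta>"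
  shows "\<exists>K. \<forall>t\<ge>0. t * (1 - norm (flow h t z)) / norm (1 - flow h t z) \<le> K"
proof -
  let ?F = "\<lambda>t. flow h t z"
  \<comment> \<open>Rotation and translation carry the half-plane to the right half-plane.\<close>
  define f where "f = (\<lambda>w. of_real (- \<sigma>) * \<i> * h w - of_real c)"
  have Re_f: "Re (f w) = \<sigma> * Im (h w) - c" for w
    by (simp add: f_def)
  have D: "norm (deriv h (?F t)) * (1 - norm (?F t)) \<le> 2 * (\<sigma> * Im (h z) - c)" if "0 \<le> t" for t
  proof -
    have F: "?F t \<in> \<Delta>"
      by (rule flow_in_disk[OF z that])
    have sub: "ball (?F t) (1 - norm (?F t)) \<subseteq> \<Delta>"
    proof
      fix w assume "w \<in> ball (?F t) (1 - norm (?F t))"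
      then show "w \<in> \<Delta>"
        using norm_triangle_sub[of w "?F t"] by (simp add: dist_norm norm_minus_commute)
    qed
    have "(f has_field_derivative of_real (- \<sigma>) * \<i> * deriv h (?F t) - 0) (at (?F t))"
      unfolding f_def using holomorphic_derivI[OF holomorphic _ F]
      by (intro DERIV_diff DERIV_cmult DERIV_const) auto
    then have "deriv f (?F t) = of_real (- \<sigma>) * \<i> * deriv h (?F t)"
      using DERIV_imp_deriv by fastforce
    then have "norm (deriv f (?F t)) = norm (deriv h (?F t))"
      using \<sigma> by (simp add: norm_mult)
    moreover have "(1 - norm (?F t)) * norm (deriv f (?F t)) \<le> 2 * Re (f (?F t))"
    proof (rule deriv_le_of_Re_pos)
      show "f holomorphic_on ball (?F t) (1 - norm (?F t))"
        unfolding f_def using holomorphic_on_subset[OF holomorphic sub] by (intro holomorphic_intros)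
      show "0 < 1 - norm (?F t)"
        using F by simp
      show "0 < Re (f w)" if "w \<in> ball (?F t) (1 - norm (?F t))" for w
        using half sub that unfolding Re_f by fastforce
    qed
    ultimately show ?thesis
      using h_flow[OF z that] by (simp add: Re_f mult.commute)
  qed
  obtain T where T: "\<And>t. T \<le> t \<Longrightarrow> t * (1 - norm (?F t)) / norm (1 - ?F t)
        \<le> 2 / \<alpha> * (norm (deriv h (?F t)) * (1 - norm (?F t)))"
    using quotient_asymptotics[OF z] unfolding eventually_at_top_linorder by blast
  show ?thesis
  proof (intro exI allI impI)
    fix t :: real assume t: "0 \<le> t"
    \<comment> \<open>The asymptotic bound holds only from \<open>T\<close> on; before that the
      quotient is at most \<open>t\<close>, since
      \<open>1 - norm F \<le> norm (1 - F)\<close>.\<close>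
    let ?K = "2 / \<alpha> * (2 * (\<sigma> * Im (h z) - c))"
    show "t * (1 - norm (?F t)) / norm (1 - ?F t) \<le> max \<bar>T\<bar> ?K"
    proof (cases "T \<le> t")
      case True
      have "2 / \<alpha> * (norm (deriv h (?F t)) * (1 - norm (?F t))) \<le> ?K"
        using D[OF t] \<alpha>_pos by (intro mult_left_mono) auto
      then show ?thesis
        using T[OF True] by linarith
    next
      case False
      have "1 - norm (?F t) \<le> norm (1 - ?F t)"
        using norm_triangle_ineq2[of 1 "?F t"] by simp
      then have "t * ((1 - norm (?F t)) / norm (1 - ?F t)) \<le> t * 1"
        using t by (intro mult_left_mono) (auto simp: divide_le_eq_1)
      then show ?thesis
        using False by simp
    qed
  qed
qed

text \<open>The inverse \<open>g\<close> of \<open>h\<close> takes values in the disk, so \<open>1 - cnj u * g\<close> with \<open>u\<close> the unit vector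
  in direction \<open>z\<close> has positive real part, equal to \<open>1 - norm z\<close> at \<open>h z\<close>.\<close>

lemma dist_complement_le:
  assumes z: "z \<in> \<Delta>" and R: "0 < R" "ball (h z) R \<subseteq> h ` \<Delta>"
  shows "R \<le> 2 * (norm (deriv h z) * (1 - norm z))"
proof -
  obtain g where holg: "g holomorphic_on h ` \<Delta>"
    and dg: "\<And>z. z \<in> \<Delta> \<Longrightarrow> deriv h z * deriv g (h z) = 1"
    and gh: "\<And>z. z \<in> \<Delta> \<Longrightarrow> g (h z) = z"
    using holomorphic_has_inverse[OF holomorphic open_ball inj] by blast
  \<comment> \<open>At \<open>z = 0\<close> there is no direction, and 1 is taken as the unit
    vector.\<close>
  obtain u where u: "norm u = 1" "z = of_real (norm z) * u"
  proof (cases "z = 0")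
    case True
    then show ?thesis using that[of 1] by simp
  next
    case False
    then have "norm (sgn z) = 1" "z = of_real (norm z) * sgn z"
      by (simp_all add: norm_sgn) (simp add: sgn_eq)
    then show ?thesis by (rule that)
  qed
  define f where "f = (\<lambda>w. 1 - cnj u * g w)"
  have "cnj u * u = 1"
    using u(1) complex_norm_square[of u] by (simp add: mult.commute)
  then have "cnj u * (of_real (norm z) * u) = of_real (norm z)"
    by (simp add: mult.left_commute)
  then have "cnj u * z = of_real (norm z)"
    using u(2) by metis
  then have "Re (f (h z)) = 1 - norm z"
    by (simp add: f_def gh[OF z] del: complex_cnj_mult)
  moreover have df: "(f has_field_derivative 0 - cnj u * deriv g (h z)) (at (h z))"
    unfolding f_def using holomorphic_derivI[OF holg _ imageI[OF z]] open_mapping_thm3[OF holomorphic _ inj]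
    by (intro DERIV_diff DERIV_cmult DERIV_const) auto
  moreover have "R * norm (deriv f (h z)) \<le> 2 * Re (f (h z))"
  proof (rule deriv_le_of_Re_pos)
    show "f holomorphic_on ball (h z) R"
      unfolding f_def using holomorphic_on_subset[OF holg R(2)] by (intro holomorphic_intros)
    show "0 < Re (f w)" if "w \<in> ball (h z) R" for w
    proof -
      have "w \<in> h ` \<Delta>"
        using R(2) that by blast
      then obtain v where v: "v \<in> \<Delta>" "w = h v"
        by blast
      then have "norm (cnj u * g w) < 1"
        using u(1) gh by (simp add: norm_mult)
      then show ?thesis
        using complex_Re_le_cmod[of "cnj u * g w"] unfolding f_def by (simp del: complex_Re_le_cmod)
    qed
  qed (fact R(1))
  ultimately have *: "R * norm (deriv g (h z)) \<le> 2 * (1 - norm z)"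
    using u(1) by (simp add: DERIV_imp_deriv[OF df] norm_mult)
  \<comment> \<open>The derivatives of \<open>h\<close> and \<open>g\<close> are reciprocal, which
    turns the bound for \<open>g\<close> into one for \<open>h\<close>.\<close>
  have "norm (deriv h z) * norm (deriv g (h z)) = 1"
    using dg[OF z] by (metis norm_mult norm_one)
  then have "R = norm (deriv h z) * (R * norm (deriv g (h z)))"
    by (simp add: mult.left_commute)
  also have "\<dots> \<le> norm (deriv h z) * (2 * (1 - norm z))"
    using * by (intro mult_left_mono) auto
  finally show ?thesis
    by (simp add: algebra_simps)
qed

text \<open>A single trajectory suffices: for all large \<open>t\<close> the disc of a fixed radius
  \<open>R\<close> about \<open>h z + t\<close> leaves the image, and its centre moves right at
  constant height.\<close>

lemma half_plane_of_bounded: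
  assumes z: "z \<in> \<Delta>"
    and bdd: "\<And>t. 0 \<le> t \<Longrightarrow> t * (1 - norm (flow h t z)) / norm (1 - flow h t z) \<le> K"
  shows "\<exists>H. horizontal_half_plane H \<and> h ` \<Delta> \<subseteq> H"
proof (rule starlike_at_infinity_half_plane)
  show "connected (h ` \<Delta>)"
    by (intro connected_continuous_image holomorphic_on_imp_continuous_on holomorphic convex_connected convex_ball)
  show "open (h ` \<Delta>)"
    by (rule open_mapping_thm3[OF holomorphic open_ball inj])
  show "w + of_real t \<in> h ` \<Delta>" if "w \<in> h ` \<Delta>" "0 \<le> t" for w t
    using that Sigma by (auto simp: Sigma_class_def)
  \<comment> \<open>Larger than \<open>4 * \<alpha> * K\<close>, twice the eventual bound for
    \<open>norm (deriv h F) * (1 - norm F)\<close>; the maximum ensures positivity.\<close>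
  define R where "R = max 1 (1 + 4 * \<alpha> * K)"
  have "0 < R"
    by (simp add: R_def)
  fix T :: real
  \<comment> \<open>The second condition puts every point within \<open>R\<close> of
    \<open>h z + t\<close> to the right of \<open>T\<close>.\<close>
  have "\<forall>\<^sub>F t in at_top. norm (deriv h (flow h t z)) * (1 - norm (flow h t z))
        \<le> 2 * \<alpha> * (t * (1 - norm (flow h t z)) / norm (1 - flow h t z))
      \<and> max 0 (T - Re (h z) + R) \<le> t"
    using quotient_asymptotics[OF z] eventually_ge_at_top[of "max 0 (T - Re (h z) + R)"]
    by eventually_elim simp
  then obtain t where t: "max 0 (T - Re (h z) + R) \<le> t"
    and le: "norm (deriv h (flow h t z)) * (1 - norm (flow h t z))
        \<le> 2 * \<alpha> * (t * (1 - norm (flow h t z)) / norm (1 - flow h t z))"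
    using eventually_happens' trivial_limit_at_top_linorder by blast
  have t0: "0 \<le> t"
    using t by simp
  have "2 * \<alpha> * (t * (1 - norm (flow h t z)) / norm (1 - flow h t z)) \<le> 2 * \<alpha> * K"
    using bdd[OF t0] \<alpha>_pos by (intro mult_left_mono) auto
  then have "2 * (norm (deriv h (flow h t z)) * (1 - norm (flow h t z))) < R"
    using le unfolding R_def by linarith
  then have "\<not> ball (h (flow h t z)) R \<subseteq> h ` \<Delta>"
    using dist_complement_le[OF flow_in_disk[OF z t0], of R] \<open>0 < R\<close> by linarith
  then obtain \<zeta> where \<zeta>_ball: "\<zeta> \<in> ball (h (flow h t z)) R" and \<zeta>: "\<zeta> \<notin> h ` \<Delta>"
    by blast
  have \<zeta>_dist: "norm (\<zeta> - (h z + of_real t)) < R"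
    using \<zeta>_ball unfolding h_flow[OF z t0] by (simp add: dist_norm norm_minus_commute)
  have "\<bar>Re \<zeta> - (Re (h z) + t)\<bar> < R" "\<bar>Im \<zeta> - Im (h z)\<bar> < R"
    using \<zeta>_dist abs_Re_le_cmod[of "\<zeta> - (h z + of_real t)"] abs_Im_le_cmod[of "\<zeta> - (h z + of_real t)"]
    by auto
  then show "\<exists>\<zeta>. \<zeta> \<notin> h ` \<Delta> \<and> T \<le> Re \<zeta> \<and> \<bar>Im \<zeta>\<bar> \<le> \<bar>Im (h z)\<bar> + R"
    using \<zeta> t by (intro exI[of _ \<zeta>]) auto
qed

section \<open>The argument of \<mu>\<close>

text \<open>At \<open>1 - \<rho> * cis \<theta>\<close> the function \<open>h\<close> is asymptotic
  to \<open>\<mu> / \<alpha> * \<rho> powr - \<alpha> * cis (- \<alpha> * \<theta>)\<close>. Scaling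
  the half-plane inequality by \<open>\<rho> powr \<alpha>\<close> removes the height
  \<open>c\<close> in the limit and leaves the sign of the sine.\<close>

lemma radial_sin_nonneg:
  assumes half: "\<And>w. w \<in> \<Delta> \<Longrightarrow> c < \<sigma> * Im (h w)" and \<theta>: "\<bar>\<theta>\<bar> < pi / 2"
  shows "0 \<le> \<sigma> * sin (Arg \<mu> - \<alpha> * \<theta>)"
proof -
  define \<zeta> where "\<zeta> = (\<lambda>\<rho>::real. 1 - of_real \<rho> * cis \<theta>)"
  have cos: "0 < cos \<theta>"
    using \<theta> by (intro cos_gt_zero_pi) auto
  have in_disk: "\<zeta> \<rho> \<in> \<Delta>" if "0 < \<rho>" "\<rho> < 2 * cos \<theta>" for \<rho>
  proof -
    have "(norm (\<zeta> \<rho>))\<^sup>2 = (1 - \<rho> * cos \<theta>)\<^sup>2 + (\<rho> * sin \<theta>)\<^sup>2"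
      unfolding \<zeta>_def cmod_power2 by simp
    also have "\<dots> = 1 - 2 * \<rho> * cos \<theta> + \<rho>\<^sup>2 * ((sin \<theta>)\<^sup>2 + (cos \<theta>)\<^sup>2)"
      by algebra
    also have "\<dots> = 1 - \<rho> * (2 * cos \<theta> - \<rho>)"
      by (simp add: power2_eq_square algebra_simps)
    also have "\<dots> < 1\<^sup>2"
      using that by simp
    finally show ?thesis
      using power2_less_imp_less by fastforce
  qed
  have ev: "\<forall>\<^sub>F \<rho> in at_right 0. 0 < \<rho> \<and> \<rho> < 2 * cos \<theta>"
    using cos by (simp add: eventually_at_right) (metis mult_pos_pos zero_less_numeral)
  have "(\<zeta> \<longlongrightarrow> 1 - of_real 0 * cis \<theta>) (at_right 0)"
    unfolding \<zeta>_def by (intro tendsto_intros)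
  moreover have "\<forall>\<^sub>F \<rho> in at_right 0. \<zeta> \<rho> \<in> \<Delta> \<and> \<zeta> \<rho> \<noteq> 1"
    using ev by eventually_elim (use in_disk in force)
  ultimately have "filterlim \<zeta> (at 1 within \<Delta>) (at_right 0)"
    by (simp add: filterlim_at)
  then have lim: "((\<lambda>\<rho>. (1 - \<zeta> \<rho>) powr of_real \<alpha> * h (\<zeta> \<rho>)) \<longlongrightarrow> \<mu> / of_real \<alpha>) (at_right 0)"
    by (rule filterlim_compose[OF lim_h])
  have powr: "(1 - \<zeta> \<rho>) powr of_real \<alpha> = of_real (\<rho> powr \<alpha>) * cis (\<alpha> * \<theta>)" if "0 < \<rho>" for \<rho>
  proof -
    have eq: "1 - \<zeta> \<rho> = exp (of_real (ln \<rho>) + \<i> * of_real \<theta>)"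
      using that by (simp add: \<zeta>_def exp_add cis_conv_exp exp_of_real)
    \<comment> \<open>Since \<open>\<bar>\<theta>\<bar> < pi / 2\<close>, the exponent lies in the
      principal strip and the power is computed without a jump.\<close>
    have Ln_eq: "Ln (exp (of_real (ln \<rho>) + \<i> * of_real \<theta>)) = of_real (ln \<rho>) + \<i> * of_real \<theta>"
      using \<theta> by (intro Ln_exp) auto
    have powr_eq: "(1 - \<zeta> \<rho>) powr of_real \<alpha> = exp (of_real (\<alpha> * ln \<rho>) + \<i> * of_real (\<alpha> * \<theta>))"
      unfolding eq powr_def Ln_eq by (simp add: algebra_simps)
    have "\<rho> powr \<alpha> = exp (\<alpha> * ln \<rho>)"
      using that unfolding powr_def by simp
    then have "complex_of_real (\<rho> powr \<alpha>) = exp (of_real (\<alpha> * ln \<rho>))"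
      by (simp only: exp_of_real)
    then show ?thesis
      by (simp only: powr_eq exp_add cis_conv_exp)
  qed
  \<comment> \<open>The factor \<open>cis (- (\<alpha> * \<theta>))\<close> undoes the rotation by
    the power, so that only the positive scale \<open>\<rho> powr \<alpha>\<close> acts on
    \<open>h\<close>.\<close>
  have lim_Im: "((\<lambda>\<rho>. \<sigma> * Im ((1 - \<zeta> \<rho>) powr of_real \<alpha> * h (\<zeta> \<rho>) * cis (- (\<alpha> * \<theta>))))
      \<longlongrightarrow> \<sigma> * Im (\<mu> / of_real \<alpha> * cis (- (\<alpha> * \<theta>)))) (at_right 0)"
    by (rule tendsto_mult[OF tendsto_const tendsto_Im[OF tendsto_mult[OF lim tendsto_const]]])
  have lim_c: "((\<lambda>\<rho>. c * \<rho> powr \<alpha>) \<longlongrightarrow> c * 0 powr \<alpha>) (at_right 0)"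
    using \<alpha>_pos eventually_mono[OF ev, of "\<lambda>\<rho>. 0 \<le> \<rho>"]
    by (intro tendsto_mult tendsto_const tendsto_powr' tendsto_ident_at) auto
  have le: "\<forall>\<^sub>F \<rho> in at_right 0. c * \<rho> powr \<alpha> \<le>
      \<sigma> * Im ((1 - \<zeta> \<rho>) powr of_real \<alpha> * h (\<zeta> \<rho>) * cis (- (\<alpha> * \<theta>)))"
    using ev
  proof eventually_elim
    case (elim \<rho>)
    have "(1 - \<zeta> \<rho>) powr of_real \<alpha> * h (\<zeta> \<rho>) * cis (- (\<alpha> * \<theta>)) =
        of_real (\<rho> powr \<alpha>) * h (\<zeta> \<rho>) * (cis (\<alpha> * \<theta>) * cis (- (\<alpha> * \<theta>)))"
      using powr elim by simp
    also have "\<dots> = of_real (\<rho> powr \<alpha>) * h (\<zeta> \<rho>)"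
      by (simp add: cis_mult)
    finally have rotate: "(1 - \<zeta> \<rho>) powr of_real \<alpha> * h (\<zeta> \<rho>) * cis (- (\<alpha> * \<theta>)) =
        of_real (\<rho> powr \<alpha>) * h (\<zeta> \<rho>)" .
    have "\<sigma> * Im ((1 - \<zeta> \<rho>) powr of_real \<alpha> * h (\<zeta> \<rho>) * cis (- (\<alpha> * \<theta>))) =
        \<rho> powr \<alpha> * (\<sigma> * Im (h (\<zeta> \<rho>)))"
      unfolding rotate by simp
    moreover have "\<rho> powr \<alpha> * c \<le> \<rho> powr \<alpha> * (\<sigma> * Im (h (\<zeta> \<rho>)))"
      using half[OF in_disk, of \<rho>] elim by (intro mult_left_mono) auto
    ultimately show ?case
      by (simp only: mult.commute[of c])
  qed
  have lower: "c * 0 powr \<alpha> \<le> \<sigma> * Im (\<mu> / of_real \<alpha> * cis (- (\<alpha> * \<theta>)))"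
    by (rule tendsto_le[OF trivial_limit_at_right_real lim_Im lim_c le])
  have polar: "\<mu> / of_real \<alpha> * cis (- (\<alpha> * \<theta>)) = of_real (norm \<mu> / \<alpha>) * cis (Arg \<mu> - \<alpha> * \<theta>)"
  proof -
    have \<mu>_eq: "of_real (norm \<mu>) * cis (Arg \<mu>) = \<mu>"
      using rcis_cmod_Arg[of \<mu>] unfolding rcis_def .
    have "of_real (norm \<mu> / \<alpha>) * cis (Arg \<mu> - \<alpha> * \<theta>) =
        of_real (norm \<mu>) * cis (Arg \<mu>) / of_real \<alpha> * cis (- (\<alpha> * \<theta>))"
      using cis_mult[of "Arg \<mu>" "- (\<alpha> * \<theta>)"] by simp
    then show ?thesis
      unfolding \<mu>_eq by (rule sym)
  qed
  have "norm \<mu> / \<alpha> * 0 \<le> \<sigma> * Im (of_real (norm \<mu> / \<alpha>) * cis (Arg \<mu> - \<alpha> * \<theta>))"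
    using lower unfolding polar by simp
  also have "\<dots> = norm \<mu> / \<alpha> * (\<sigma> * sin (Arg \<mu> - \<alpha> * \<theta>))"
    unfolding times_complex.sel by simp
  finally show ?thesis
    by (rule mult_left_le_imp_le) (use \<mu>_nz \<alpha>_pos in simp)
qed

text \<open>\<open>1 - F\<close> has argument below \<open>pi / 2\<close> in modulus, so its power
  has argument at most \<open>pi / 2 * \<alpha>\<close>. Positive scaling preserves this, and it
  passes to the limit \<open>\<mu> / \<alpha>\<close>, which has the argument of \<mu>.\<close>

lemma abs_Arg_\<mu>_le:
  assumes "\<alpha> \<le> 1"
  shows "\<bar>Arg \<mu>\<bar> \<le> pi / 2 * \<alpha>"
proof -
  let ?p = "\<lambda>t. (1 - flow h t 0) powr of_real \<alpha>"
  have z: "0 \<in> \<Delta>"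
    by simp
  have Arg_p: "\<bar>Arg (?p t)\<bar> \<le> pi / 2 * \<alpha>" if "0 \<le> t" for t
  proof -
    have "0 < Re (1 - flow h t 0)"
      using norm_flow_less_1[OF z that] abs_Re_le_cmod[of "flow h t 0"] by simp
    then have "\<bar>Im (Ln (1 - flow h t 0))\<bar> < pi / 2"
      by (rule Re_Ln_pos_lt_imp)
    then have le: "\<alpha> * \<bar>Im (Ln (1 - flow h t 0))\<bar> \<le> \<alpha> * (pi / 2)"
      using \<alpha>_pos by (intro mult_left_mono) auto
    \<comment> \<open>Hence multiplying the argument by \<alpha> causes no wrap-around.\<close>
    have "\<alpha> * (pi / 2) < pi"
      using assms pi_gt_zero by (smt (verit) mult_left_le_one_le field_sum_of_halves \<alpha>_pos)
    have nz: "1 - flow h t 0 \<noteq> 0"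
      using norm_flow_less_1[OF z that] by auto
    define x where "x = \<alpha> * Im (Ln (1 - flow h t 0))"
    have x: "\<bar>x\<bar> \<le> \<alpha> * (pi / 2)"
      using le \<alpha>_pos by (simp add: x_def abs_mult)
    have Im_x: "Im (of_real \<alpha> * Ln (1 - flow h t 0)) = x"
      by (simp add: x_def)
    have "- pi < x" "x \<le> pi"
      using x \<open>\<alpha> * (pi / 2) < pi\<close> by linarith+
    then have "Arg (?p t) = x"
      using nz Arg_exp[of "of_real \<alpha> * Ln (1 - flow h t 0)"] unfolding Im_x by (simp add: powr_def)
    then show ?thesis
      using x by (simp add: mult.commute)
  qed
  \<comment> \<open>Before passing to the limit in \<open>Arg\<close>, its continuity is secured:
    the nonzero limit lies in the closed right half-plane, off the branch cut.\<close>
  have "\<forall>\<^sub>F t in at_top. 0 \<le> Re (of_real t * ?p t)"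
    using eventually_ge_at_top[of 0]
  proof eventually_elim
    case (elim t)
    have "pi / 2 * \<alpha> \<le> pi / 2"
      using assms by (simp add: mult_left_le)
    then have "\<bar>Arg (?p t)\<bar> \<le> pi / 2"
      using Arg_p[OF elim] by linarith
    then have "0 \<le> Re (?p t)"
      unfolding Arg_Re_nonneg .
    then show ?case
      using elim by simp
  qed
  then have "0 \<le> Re (\<mu> / of_real \<alpha>)"
    using tendsto_lowerbound[OF tendsto_Re[OF lim_flow_powr[OF z]]] trivial_limit_at_top_linorder by blast
  moreover have "\<mu> / of_real \<alpha> \<noteq> 0"
    using \<mu>_nz \<alpha>_pos by simp
  ultimately have "\<mu> / of_real \<alpha> \<notin> \<real>\<^sub>\<le>\<^sub>0"
    by (metis complex_eq_iff complex_nonpos_Reals_iff order_antisym zero_complex.sel)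
  then have "((\<lambda>t. Arg (of_real t * ?p t)) \<longlongrightarrow> Arg (\<mu> / of_real \<alpha>)) at_top"
    by (intro isCont_tendsto_compose[OF continuous_at_Arg] lim_flow_powr[OF z])
  then have "((\<lambda>t. \<bar>Arg (of_real t * ?p t)\<bar>) \<longlongrightarrow> \<bar>Arg \<mu>\<bar>) at_top"
    using tendsto_rabs \<alpha>_pos by fastforce
  moreover have "\<forall>\<^sub>F t in at_top. \<bar>Arg (of_real t * ?p t)\<bar> \<le> pi / 2 * \<alpha>"
    using eventually_gt_at_top[of 0] by eventually_elim (use Arg_p in simp)
  ultimately show ?thesis
    using tendsto_upperbound trivial_limit_at_top_linorder by blast
qed

text \<open>The inequalities on rays come first: they give \<open>\<alpha> \<le> 1\<close>, which
  the trajectory bound on \<open>Arg \<mu>\<close> presupposes. Together the two leave a single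
  value for the argument.\<close>

lemma Arg_\<mu>_of_half_plane:
  assumes "\<alpha> \<le> 2" and \<sigma>: "\<bar>\<sigma>\<bar> = 1" and half: "\<And>w. w \<in> \<Delta> \<Longrightarrow> c < \<sigma> * Im (h w)"
  shows "\<alpha> \<le> 1" and "\<sigma> * Arg \<mu> = pi / 2 * \<alpha>"
proof -
  have sin: "0 \<le> sin (\<sigma> * Arg \<mu> - x)" if x: "\<bar>x\<bar> < pi / 2 * \<alpha>" for x
  proof -
    \<comment> \<open>With \<open>\<theta> = \<sigma> * x / \<alpha>\<close>, oddness of the sine
      absorbs the outer sign \<sigma>.\<close>
    have "\<bar>\<sigma> * x / \<alpha>\<bar> < pi / 2"
      using x \<sigma> \<alpha>_pos by (simp add: abs_mult field_simps)
    then have "0 \<le> \<sigma> * sin (Arg \<mu> - \<alpha> * (\<sigma> * x / \<alpha>))"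
      by (rule radial_sin_nonneg[rotated]) (fact half)
    moreover have "\<sigma> = 1 \<or> \<sigma> = - 1"
      using \<sigma> by auto
    moreover have "sin (- Arg \<mu> - x) = - sin (Arg \<mu> + x)"
      by (simp flip: sin_minus)
    ultimately show ?thesis
      using \<alpha>_pos by auto
  qed
  show le1: "\<alpha> \<le> 1"
    by (rule sin_nonneg_interval(1)[OF \<alpha>_pos \<open>\<alpha> \<le> 2\<close> sin])
  show "\<sigma> * Arg \<mu> = pi / 2 * \<alpha>"
    using abs_Arg_\<mu>_le[OF le1] \<sigma>
    by (intro sin_nonneg_interval(2)[OF \<alpha>_pos \<open>\<alpha> \<le> 2\<close> sin]) (auto simp: abs_mult)
qed

text \<open>Dividing the bound by \<open>t\<close> squeezes the quotient between 0 and
  \<open>K / t\<close>.\<close>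

lemma tangential_of_bounded:
  assumes z: "z \<in> \<Delta>"
    and bdd: "\<And>t. 0 \<le> t \<Longrightarrow> t * (1 - norm (flow h t z)) / norm (1 - flow h t z) \<le> K"
  shows "converges_tangentially_to_1 (\<lambda>t. flow h t z)"
proof -
  let ?q = "\<lambda>t. (1 - norm (flow h t z)) / norm (1 - flow h t z)"
  have "(?q \<longlongrightarrow> 0) at_top"
  proof (rule tendsto_sandwich)
    show "\<forall>\<^sub>F t in at_top. 0 \<le> ?q t"
      using eventually_ge_at_top[of 0] by eventually_elim (use norm_flow_less_1[OF z] in \<open>simp add: less_imp_le\<close>)
    show "\<forall>\<^sub>F t in at_top. ?q t \<le> K / t"
      using eventually_gt_at_top[of 0] by eventually_elim (use bdd in \<open>simp add: field_simps\<close>)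
    show "((\<lambda>t. K / t) \<longlongrightarrow> 0) at_top"
      by (intro tendsto_divide_0[OF tendsto_const] filterlim_at_top_imp_at_infinity filterlim_ident)
  qed simp
  then show ?thesis
    using z Sigma by (simp add: converges_tangentially_to_1_def Sigma_class_def)
qed

end

section \<open>Half-planes up to sign, and assembly of the theorem\<close>

text \<open>One sign treats upper and lower half-planes together; for \<open>\<sigma> = - 1\<close>
  the edge has height \<open>- c\<close>.\<close>

lemma horizontal_half_plane_iff:
  "(\<exists>H. horizontal_half_plane H \<and> S \<subseteq> H) \<longleftrightarrow> (\<exists>\<sigma> c. \<bar>\<sigma>\<bar> = 1 \<and> (\<forall>w\<in>S. c < \<sigma> * Im w))"
proof
  assume "\<exists>H. horizontal_half_plane H \<and> S \<subseteq> H"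
  then obtain c where "(\<forall>w\<in>S. c < 1 * Im w) \<or> (\<forall>w\<in>S. - c < - 1 * Im w)"
    unfolding horizontal_half_plane_def by fastforce
  then show "\<exists>\<sigma> c. \<bar>\<sigma>\<bar> = 1 \<and> (\<forall>w\<in>S. c < \<sigma> * Im w)"
    by (metis abs_minus_cancel abs_one)
next
  assume "\<exists>\<sigma> c. \<bar>\<sigma>\<bar> = 1 \<and> (\<forall>w\<in>S. c < \<sigma> * Im w)"
  then obtain \<sigma> c where "\<sigma> = 1 \<or> \<sigma> = - 1" "\<forall>w\<in>S. c < \<sigma> * Im w"
    by (metis abs_eq_iff abs_one)
  then have "S \<subseteq> {w. Im w > c} \<or> S \<subseteq> {w. Im w < - c}"
    by auto
  then show "\<exists>H. horizontal_half_plane H \<and> S \<subseteq> H"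
    unfolding horizontal_half_plane_def by blast
qed

text \<open>\<open>z / (1 - z) + 1 / 2\<close> is half of \<open>(1 + z) / (1 - z)\<close>, which
  has positive real part. Multiplied by \<open>\<i> * b\<close>, this puts the set in assertion (d)
  on one side of the line \<open>Im w = - b / 2\<close>.\<close>

lemma Re_moebius_gt:
  assumes "norm z < 1"
  shows "- 1 / 2 < Re (z / (1 - z))"
proof -
  have "0 < (norm (1 - z))\<^sup>2"
    using assms by auto
  moreover have "Re (z / (1 - z)) + 1 / 2 = (1 - (norm z)\<^sup>2) / (2 * (norm (1 - z))\<^sup>2)"
    using calculation unfolding Re_divide cmod_power2
    by (simp add: field_simps power2_eq_square)
  moreover have "(norm z)\<^sup>2 < 1"
    using assms by (simp add: power_less_one_iff)
  ultimately have "0 < Re (z / (1 - z)) + 1 / 2"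
    by simp
  then show ?thesis
    by simp
qed

lemma SUP_ereal_less_infinity_iff:
  assumes "A \<noteq> {}"
  shows "(SUP t\<in>A. ereal (f t)) < \<infinity> \<longleftrightarrow> (\<exists>K. \<forall>t\<in>A. f t \<le> K)"
proof
  assume "(SUP t\<in>A. ereal (f t)) < \<infinity>"
  then obtain n :: nat where "(SUP t\<in>A. ereal (f t)) < ereal (real n)"
    using less_PInf_Ex_of_nat by (metis less_irrefl)
  then have "\<forall>t\<in>A. f t \<le> real n"
    by (metis SUP_lessD ereal_less_eq(3) less_imp_le)
  then show "\<exists>K. \<forall>t\<in>A. f t \<le> K"
    by blast
next
  assume "\<exists>K. \<forall>t\<in>A. f t \<le> K"
  then obtain K where "\<forall>t\<in>A. f t \<le> K" ..
  then have "(SUP t\<in>A. ereal (f t)) \<le> ereal K"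
    by (auto intro: SUP_least)
  also have "ereal K < \<infinity>"
    by simp
  finally show "(SUP t\<in>A. ereal (f t)) < \<infinity>" .
qed

theorem theorem18:
  fixes h :: "complex \<Rightarrow> complex" and \<alpha> :: real and \<mu> :: complex
  assumes "0 < \<alpha>" and "\<alpha> \<le> 2"
    and "h \<in> Sigma_alpha \<alpha>"
    and "((\<lambda>z. (1 - z) powr of_real (1 + \<alpha>) * deriv h z) \<longlongrightarrow> \<mu>) (at 1 within \<Delta>)"
  shows "((\<exists>H. horizontal_half_plane H \<and> h ` \<Delta> \<subseteq> H) \<longleftrightarrow>
          (\<forall>z\<in>\<Delta>. (SUP t\<in>{0..}. ereal (t * (1 - norm (flow h t z)) / norm (1 - flow h t z))) < \<infinity>))
       \<and> ((\<exists>H. horizontal_half_plane H \<and> h ` \<Delta> \<subseteq> H) \<longrightarrow>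
            \<alpha> \<in> {0<..1}
          \<and> \<bar>Arg \<mu>\<bar> = pi / 2 * \<alpha>
          \<and> (\<forall>z\<in>\<Delta>. converges_tangentially_to_1 (\<lambda>t. flow h t z))
          \<and> (\<forall>b::real. b \<noteq> 0 \<longrightarrow>
               h ` \<Delta> \<subseteq> {\<i> * of_real b * z / (1 - z) | z. z \<in> \<Delta>} \<longrightarrow> b * Arg \<mu> > 0))"
proof -
  obtain \<nu> where "\<nu> \<noteq> 0" and \<nu>: "((\<lambda>z. (1 - z) powr of_real (1 + \<alpha>) * deriv h z) \<longlongrightarrow> \<nu>) (at 1 within \<Delta>)"
    and Sigma: "h \<in> Sigma_class"
    using assms(3) by (auto simp: Sigma_alpha_def)
  \<comment> \<open>As 1 is a limit point of the disk, the given limit \<mu> coincides with the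
    nonzero one provided by \<open>Sigma_alpha\<close>.\<close>
  have "at (1::complex) within \<Delta> \<noteq> bot"
    using islimpt_ball[of "1::complex" 0 1] by (simp add: trivial_limit_within)
  then have "\<mu> = \<nu>"
    using tendsto_unique assms(4) \<nu> by blast
  then interpret Sigma_asymptotics h \<alpha> \<mu>
    using assms(1,4) Sigma \<open>\<nu> \<noteq> 0\<close> by unfold_locales auto
  let ?half = "\<exists>H. horizontal_half_plane H \<and> h ` \<Delta> \<subseteq> H"
  let ?q = "\<lambda>z t. t * (1 - norm (flow h t z)) / norm (1 - flow h t z)"
  have SUP_iff: "(SUP t\<in>{0..}. ereal (?q z t)) < \<infinity> \<longleftrightarrow> (\<exists>K. \<forall>t\<ge>0. ?q z t \<le> K)" for z
    by (subst SUP_ereal_less_infinity_iff) auto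
  have bounded: "\<exists>K. \<forall>t\<ge>0. ?q z t \<le> K" if half: ?half and z: "z \<in> \<Delta>" for z
  proof -
    obtain \<sigma> c where "\<bar>\<sigma>\<bar> = 1" "\<And>w. w \<in> \<Delta> \<Longrightarrow> c < \<sigma> * Im (h w)"
      using half unfolding horizontal_half_plane_iff by blast
    then show ?thesis
      by (rule bounded_of_half_plane[OF _ _ z])
  qed
  have "?half" if "\<forall>z\<in>\<Delta>. \<exists>K. \<forall>t\<ge>0. ?q z t \<le> K"
  proof -
    obtain K where "\<forall>t\<ge>0. ?q 0 t \<le> K"
      using \<open>\<forall>z\<in>\<Delta>. \<exists>K. \<forall>t\<ge>0. ?q z t \<le> K\<close> by fastforce
    then show ?thesis
      by (intro half_plane_of_bounded[of 0 K]) auto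
  qed
  then have iff: "?half \<longleftrightarrow> (\<forall>z\<in>\<Delta>. (SUP t\<in>{0..}. ereal (?q z t)) < \<infinity>)"
    unfolding SUP_iff using bounded by blast
  have Arg_\<mu>: "\<alpha> \<in> {0<..1} \<and> \<bar>Arg \<mu>\<bar> = pi / 2 * \<alpha>" if ?half
  proof -
    obtain \<sigma> c where \<sigma>: "\<bar>\<sigma>\<bar> = 1" and c: "\<And>w. w \<in> \<Delta> \<Longrightarrow> c < \<sigma> * Im (h w)"
      using \<open>?half\<close> unfolding horizontal_half_plane_iff by blast
    have *: "\<alpha> \<le> 1" "\<sigma> * Arg \<mu> = pi / 2 * \<alpha>"
      by (rule Arg_\<mu>_of_half_plane[OF assms(2) \<sigma> c], assumption)+
    have "\<bar>Arg \<mu>\<bar> = \<bar>\<sigma> * Arg \<mu>\<bar>"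
      using \<sigma> by (simp add: abs_mult)
    then show ?thesis
      using * assms(1) by simp
  qed
  have tangential: "converges_tangentially_to_1 (\<lambda>t. flow h t z)" if half: ?half and z: "z \<in> \<Delta>" for z
  proof -
    obtain K where "\<forall>t\<ge>0. ?q z t \<le> K"
      using bounded[OF half z] ..
    then show ?thesis
      by (intro tangential_of_bounded[OF z, of K]) auto
  qed
  have sign: "b * Arg \<mu> > 0"
    if b: "b \<noteq> 0" and sub: "h ` \<Delta> \<subseteq> {\<i> * of_real b * z / (1 - z) | z. z \<in> \<Delta>}" for b :: real
  proof -
    \<comment> \<open>Here \<open>sgn b\<close> takes the role of \<sigma>; as
      \<open>sgn b * Arg \<mu>\<close> is then \<open>pi / 2 * \<alpha>\<close>, a positive number,
      \<open>b\<close> and \<open>Arg \<mu>\<close> have the same sign.\<close>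
    have half: "- \<bar>b\<bar> / 2 < sgn b * Im (h w)" if w: "w \<in> \<Delta>" for w
    proof -
      obtain z where z: "z \<in> \<Delta>" "h w = \<i> * of_real b * z / (1 - z)"
        using sub w by blast
      define q where "q = z / (1 - z)"
      have "h w = \<i> * of_real b * q"
        using z by (simp add: q_def)
      then have "sgn b * Im (h w) = \<bar>b\<bar> * Re q"
        by (simp add: abs_sgn mult_ac)
      moreover have "\<bar>b\<bar> * (- 1 / 2) < \<bar>b\<bar> * Re q"
        unfolding q_def using Re_moebius_gt[of z] z(1) b by (intro mult_strict_left_mono) auto
      ultimately show ?thesis
        by simp
    qed
    have "\<bar>sgn b\<bar> = 1"
      using b by (simp add: sgn_if)
    then have sgn_Arg: "sgn b * Arg \<mu> = pi / 2 * \<alpha>"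
      by (rule Arg_\<mu>_of_half_plane(2)[OF assms(2) _ half])
    have "b * Arg \<mu> = sgn b * \<bar>b\<bar> * Arg \<mu>"
      by (simp only: sgn_mult_abs)
    also have "\<dots> = \<bar>b\<bar> * (sgn b * Arg \<mu>)"
      by (simp only: mult_ac)
    also note sgn_Arg
    also have "\<bar>b\<bar> * (pi / 2 * \<alpha>) > 0"
      using b assms(1) by (intro mult_pos_pos) auto
    finally show ?thesis .
  qed
  show ?thesis
  proof (intro conjI impI ballI allI)
    assume ?half
    from Arg_\<mu>[OF this] show "\<alpha> \<in> {0<..1}" "\<bar>Arg \<mu>\<bar> = pi / 2 * \<alpha>"
      by blast+
  qed (fact iff, fact tangential, rule sign)
qed

end
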